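(* Let $d=1$, $\Gamma_N=\{1,\dots,N\}$, and let $\mathcal{A}_{\Gamma_N}$ be the Dirichlet-truncated adjacency matrix on $\Gamma_N$. Then: (a) All eigenvalues of $\mathcal{A}_{\Gamma_N}$ are simple, and its orthonormal eigenbasis $\{\psi_N^{(j)}\}_{j=1}^N$ is (up to unimodular scalars) explicit: $$\psi_N^{(j)}(x)=s_N^{(j)}(x):=\sqrt{\tfrac{2}{N+1}}\,\sin\tfrac{j\pi x}{N+1},\qquad x\in\Gamma_N,$$ with corresponding eigenvalue $\lambda_N^{(j)}=2\cos\frac{j\pi}{N+1}$, $1\le j\le N$. (b) For every fixed integer $R\ge0$ and all integers $z$ with $|z|\le R$, $$\langle s_N^{(j)},\rho_zs_N^{(j)}\rangle=\cos\Big(\frac{|z|j\pi}{N+1}\Big)+O\Big(\frac1N\Big),$$ where the implied constant depends only on $R$ (in particular it is uniform in $1\le j\le N$). (c) Let $R\ge0$ be a fixed integer and let $K_N:\Gamma_N\times\Gamma_N\to\mathbb{C}$, $N\in\mathbb{N}$, satisfy $K_N(x,y)=0$ whenever $|x-y|>R$ and $|K_N(x,y)|\le1$ for all $x,y\in\Gamma_N$. Then $$\lim_{N\to\infty}\frac1N\sum_{j=1}^N\Big|\langle\psi_N^{(j)},K_N\psi_N^{(j)}\rangle-\sum_{z}\sum_{x\in L_z}\frac{1}{\#L_z}K_N(x,x+z)\cos\frac{|z|j\pi}{N+1}\Big|^2=0,$$ where the sum is over integers $z$ with $L_z\ne\emptyset$. Moreover $\cos\frac{|z|j\pi}{N+1}=\Phi_{\lambda_N^{(j)}}(|z|)$,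 where $\Phi_\lambda(n):=\cos\left(n\arccos\frac\lambda2\right)$ is the spherical function of $\mathbb{Z}$, and $$\lim_{N\to\infty}\frac1N\sum_{j=1}^N\left|\langle\psi_N^{(j)},K_N\psi_N^{(j)}\rangle-\langle K_N\rangle_{\lambda_N^{(j)}}\right|^2=0,\qquad \langle K_N\rangle_{\lambda}:=\frac1N\sum_{x,y\in\Gamma_N}K_N(x,y)\,\Phi_{\lambda}(|x-y|).$$
   Context: $\mathbb{N}$ denotes the positive integers. $\ell^2(\Gamma_N)$ is the space of functions $\Gamma_N\to\mathbb{C}$ with inner product $\langle\varphi,\psi\rangle=\sum_{x\in\Gamma_N}\overline{\varphi(x)}\psi(x)$. For $d=1$, $(\mathcal{A}_{\Gamma_N}\psi)(x)=\sum_{y\in\Gamma_N,\ |y-x|=1}\psi(y)$. A matrix $K_N:\Gamma_N\times\Gamma_N\to\mathbb{C}$ acts by $(K_N\psi)(x)=\sum_{y\in\Gamma_N}K_N(x,y)\psi(y)$. For $z\in\mathbb{Z}$, $L_z:=\{x\in\Gamma_N:\ x+z\in\Gamma_N\}$, and $(\rho_z\psi)(x):=\psi(x+z)$ if $x+z\in\Gamma_N$, $(\rho_z\psi)(x):=0$ otherwise. *)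

theory Defs
  imports Complex_Main "Jordan_Normal_Form.Char_Poly"
begin

definition Gam :: "nat \<Rightarrow> int set" where
  "Gam N = {1..int N}"

text \<open>
  A function on \<open>{1,...,N}\<close> is represented by the function on all integers that extends it
  by zero, so that equality of elements of the space is equality of functions; all operators
  below return functions of this form.
\<close>

definition l2 :: "nat \<Rightarrow> (int \<Rightarrow> complex) set" where
  "l2 N = {\<psi>. \<forall>x. x \<notin> Gam N \<longrightarrow> \<psi> x = 0}"

definition ip :: "nat \<Rightarrow> (int \<Rightarrow> complex) \<Rightarrow> (int \<Rightarrow> complex) \<Rightarrow> complex" where
  "ip N \<phi> \<psi> = (\<Sum>x\<in>Gam N. cnj (\<phi> x) * \<psi> x)"

definition adjacency :: "nat \<Rightarrow> (int \<Rightarrow> complex) \<Rightarrow> int \<Rightarrow> complex" where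
  "adjacency N \<psi> x = (if x \<in> Gam N then \<Sum>y\<in>{y\<in>Gam N. \<bar>y - x\<bar> = 1}. \<psi> y else 0)"

definition kernel_op :: "nat \<Rightarrow> (int \<Rightarrow> int \<Rightarrow> complex) \<Rightarrow> (int \<Rightarrow> complex) \<Rightarrow> int \<Rightarrow> complex" where
  "kernel_op N K \<psi> x = (if x \<in> Gam N then \<Sum>y\<in>Gam N. K x y * \<psi> y else 0)"

definition L :: "nat \<Rightarrow> int \<Rightarrow> int set" where
  "L N z = {x\<in>Gam N. x + z \<in> Gam N}"

definition rho :: "nat \<Rightarrow> int \<Rightarrow> (int \<Rightarrow> complex) \<Rightarrow> int \<Rightarrow> complex" where
  "rho N z \<psi> x = (if x \<in> L N z then \<psi> (x + z) else 0)"

text \<open>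
  The matrix of an operator \<open>T\<close> in the basis of point masses. The library indexes matrices
  from 0, so the point \<open>x\<close> corresponds to the index \<open>x - 1\<close>.
\<close>

definition op_mat :: "nat \<Rightarrow> ((int \<Rightarrow> complex) \<Rightarrow> int \<Rightarrow> complex) \<Rightarrow> complex mat" where
  "op_mat N T = mat N N (\<lambda>(i, k). T (\<lambda>y. if y = int k + 1 then 1 else 0) (int i + 1))"

definition orthonormal_eigenbasis ::
  "nat \<Rightarrow> ((int \<Rightarrow> complex) \<Rightarrow> int \<Rightarrow> complex) \<Rightarrow> (nat \<Rightarrow> complex) \<Rightarrow> (nat \<Rightarrow> int \<Rightarrow> complex) \<Rightarrow> bool"
where
  "orthonormal_eigenbasis N T \<mu> \<psi> \<longleftrightarrow>
     (\<forall>j\<in>{1..N}. \<psi> j \<in> l2 N \<and> T (\<psi> j) = (\<lambda>x. \<mu> j * \<psi> j x)) \<and>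
     (\<forall>i\<in>{1..N}. \<forall>j\<in>{1..N}. ip N (\<psi> i) (\<psi> j) = (if i = j then 1 else 0)) \<and>
     (\<forall>\<phi>\<in>l2 N. \<exists>c. \<phi> = (\<lambda>x. \<Sum>j=1..N. c j * \<psi> j x))"

definition s :: "nat \<Rightarrow> nat \<Rightarrow> int \<Rightarrow> complex" where
  "s N j x = (if x \<in> Gam N
     then complex_of_real (sqrt (2 / (real N + 1)) * sin (real j * pi * real_of_int x / (real N + 1)))
     else 0)"

definition lam :: "nat \<Rightarrow> nat \<Rightarrow> real" where
  "lam N j = 2 * cos (real j * pi / (real N + 1))"

definition Phi :: "real \<Rightarrow> nat \<Rightarrow> real" where
  "Phi l n = cos (real n * arccos (l / 2))"

definition kernel_avg :: "nat \<Rightarrow> (int \<Rightarrow> int \<Rightarrow> complex) \<Rightarrow> real \<Rightarrow> complex" where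
  "kernel_avg N K l =
     1 / of_nat N * (\<Sum>x\<in>Gam N. \<Sum>y\<in>Gam N. K x y * complex_of_real (Phi l (nat \<bar>x - y\<bar>)))"

end

(*
  Write th = j pi / (N + 1). Since s_j(x) s_j(y) = (cos((y - x) th) - cos((x + y) th)) / (N + 1),
  the claimed main term is the sum of the cos((y - x) th), up to replacing 1 / (N + 1) by another
  normalisation, and what has to be controlled are the oscillating terms cos((2x + z) th) on each
  diagonal y = x + z. For constant coefficients they nearly sum to zero, because exp(2 i th) is a
  nontrivial root of unity of order dividing N + 1; this gives (b). For arbitrary coefficients,
  the numbers exp(2 i x th), j = 0..N, are the characters of the cyclic group of order N + 1, so by
  Parseval the sum over x has mean square O(N) in j, while it gets divided by N + 1; this gives (c).
*)

theory Submission
  imports Defs "HOL-Library.Real_Mod" "HOL-Analysis.Convex"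
begin

text \<open>The sines produce the weight \<open>1 / (N + 1)\<close> on every diagonal, while the two
  averages in the statement carry \<open>1 / card (L N z)\<close> and \<open>1 / N\<close>. Along a
  diagonal with \<open>|z| \<le> R\<close> these differ by a total mass of O(1/N), so one variance
  estimate with a free weight covers both. It bounds the unnormalised sum over \<open>j\<close> by a
  constant depending on \<open>R\<close> alone; the limits thus hold with rate O(1/N). The
  eigenbasis in the limits is arbitrary, apart from the order of its eigenvalues. Since the
  eigenvalues are distinct, it differs from the sines by phases only, and phases cancel in the
  quadratic form of the kernel. Simplicity is meant algebraically, as the order of a root of the
  characteristic polynomial. It is obtained by diagonalising with the sine matrix, whose symmetry in
  position and frequency makes it its own inverse.\<close>

section \<open>Angles, eigenvalues and products of sines\<close>

definition theta :: "nat \<Rightarrow> nat \<Rightarrow> real" where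
  "theta N j = real j * pi / (real N + 1)"

lemma finite_Gam [simp]: "finite (Gam N)"
  by (simp add: Gam_def)

lemma card_Gam [simp]: "card (Gam N) = N"
  by (simp add: Gam_def)

lemma theta_range:
  assumes "j \<in> {1..N}"
  shows "0 < theta N j" "theta N j < pi"
proof -
  have "pi * real j < pi * (real N + 1)"
    using assms by (intro mult_strict_left_mono) auto
  then show "0 < theta N j" "theta N j < pi"
    using assms by (auto simp: theta_def field_simps)
qed

lemma lam_theta: "lam N j = 2 * cos (theta N j)"
  by (simp add: lam_def theta_def)

text \<open>The angles lie strictly between 0 and \<pi>, where cosine is injective. Distinct
  eigenvalues are behind orthogonality, simplicity and uniqueness of eigenvectors below.\<close>

lemma lam_inj: "inj_on (lam N) {1..N}"
proof (rule inj_onI)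
  fix i j assume ij: "i \<in> {1..N}" "j \<in> {1..N}" and "lam N i = lam N j"
  then have "cos (theta N i) = cos (theta N j)" by (simp add: lam_theta)
  then have "theta N i = theta N j"
    using theta_range[OF ij(1)] theta_range[OF ij(2)]
    by - (rule cos_inj_pi, auto)
  then show "i = j" by (simp add: theta_def)
qed

lemma lam_eq_iff: "i \<in> {1..N} \<Longrightarrow> j \<in> {1..N} \<Longrightarrow> lam N i = lam N j \<longleftrightarrow> i = j"
  by (rule inj_on_eq_iff[OF lam_inj])

lemma s_theta:
  "x \<in> Gam N \<Longrightarrow>
     s N j x = complex_of_real (sqrt (2 / (real N + 1)) * sin (real_of_int x * theta N j))"
  by (simp add: s_def theta_def mult_ac)

text \<open>The sine depends on \<open>j\<close> and \<open>k\<close> only through their product;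
  the two ranges keep both points inside the cut-off built into \<open>s\<close>.\<close>

lemma s_commute: "s N j (int k) = s N k (int j)" if "j \<in> {1..N}" "k \<in> {1..N}"
  using that by (simp add: s_def Gam_def mult_ac)

lemma cnj_s [simp]: "cnj (s N j x) = s N j x"
  by (simp add: s_def)

lemma s_mult_s:
  assumes "x \<in> Gam N" "y \<in> Gam N"
  shows "s N j x * s N j y = complex_of_real
    ((cos (real_of_int (y - x) * theta N j) - cos (real_of_int (x + y) * theta N j)) / (real N + 1))"
proof -
  have *: "sqrt (2 / (real N + 1)) * a * (sqrt (2 / (real N + 1)) * b) = 2 / (real N + 1) * (a * b)"
    for a b :: real
  proof -
    have "sqrt (2 / (real N + 1)) * a * (sqrt (2 / (real N + 1)) * b)
       = (sqrt (2 / (real N + 1)) * sqrt (2 / (real N + 1))) * (a * b)" by (simp only: mult_ac)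
    then show ?thesis by simp
  qed
  have "cos (real_of_int (y - x) * theta N j) - cos (real_of_int (x + y) * theta N j)
     = 2 * (sin (real_of_int x * theta N j) * sin (real_of_int y * theta N j))"
    by (simp add: algebra_simps cos_add cos_diff)
  then show ?thesis
    using assms by (simp add: s_theta * flip: of_real_mult)
qed

subsection \<open>Mean squares of exponential sums\<close>

lemma sum_roots_of_unity:
  fixes k :: int
  assumes "0 < n"
  shows "(\<Sum>j<n. cis (real_of_int k * real j * (2 * pi / real n))) = (if int n dvd k then of_nat n else 0)"
proof -
  define w where "w = cis (real_of_int k * (2 * pi / real n))"
  have pow: "cis (real_of_int k * real j * (2 * pi / real n)) = w ^ j" for j
    unfolding w_def by (simp add: DeMoivre mult_ac)
  have wn: "w ^ n = 1"
    using assms by (auto simp: w_def DeMoivre cis_eq_1_iff mult_ac)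
  have w1: "w = 1 \<longleftrightarrow> int n dvd k"
  proof -
    have "w = 1 \<longleftrightarrow> (\<exists>m::int. real_of_int k * (2 * pi / real n) = of_int m * (2 * pi))"
      by (simp add: w_def cis_eq_1_iff)
    also have "\<dots> \<longleftrightarrow> (\<exists>m::int. real_of_int k = real_of_int (int n * m))"
      using assms by (simp add: field_simps)
    also have "\<dots> \<longleftrightarrow> int n dvd k"
      by (simp only: of_int_eq_iff dvd_def)
    finally show ?thesis .
  qed
  show ?thesis
  proof (cases "w = 1")
    case True
    then show ?thesis using w1 by (simp only: pow) simp
  next
    case False
    then show ?thesis using w1 wn by (simp only: pow) (simp add: geometric_sum)
  qed
qed

text \<open>The index runs over all \<open>N + 1\<close> characters, including the trivial one at
  \<open>j = 0\<close>, which makes this an identity. Points of \<open>Gam N\<close> are pairwise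
  incongruent modulo \<open>N + 1\<close>, so the functions of \<open>j\<close> attached to them are
  orthogonal.\<close>

lemma parseval_cyclic:
  fixes b :: "int \<Rightarrow> complex"
  assumes "S \<subseteq> Gam N"
  shows "(\<Sum>j<N+1. (cmod (\<Sum>x\<in>S. b x * cis (2 * real_of_int x * theta N j)))\<^sup>2)
           = (real N + 1) * (\<Sum>x\<in>S. (cmod (b x))\<^sup>2)"
proof -
  have fin: "finite S" by (rule finite_subset[OF assms finite_Gam])
  define e where "e x j = cis (2 * real_of_int x * theta N j)" for x j
  have ee: "(\<Sum>j<N+1. e x j * cnj (e y j)) = (if x = y then of_nat (N+1) else 0)"
    if "x \<in> S" "y \<in> S" for x y
  proof -
    have "(\<Sum>j<N+1. e x j * cnj (e y j))
        = (\<Sum>j<N+1. cis (real_of_int (x - y) * real j * (2 * pi / real (N+1))))"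
      unfolding e_def cis_cnj cis_mult
      by (intro sum.cong refl arg_cong[where f=cis])
         (simp add: theta_def algebra_simps add_divide_distrib diff_divide_distrib)
    also have "\<dots> = (if int (N+1) dvd x - y then of_nat (N+1) else 0)"
      by (rule sum_roots_of_unity) simp
    also have "int (N+1) dvd x - y \<longleftrightarrow> x = y"
    proof -
      have "x \<in> Gam N" "y \<in> Gam N" using that assms by auto
      then have "\<bar>x - y\<bar> < int (N+1)" by (auto simp: Gam_def)
      then show ?thesis using dvd_imp_le_int[of "x - y" "int (N+1)"] by auto
    qed
    finally show ?thesis by simp
  qed
  have "complex_of_real (\<Sum>j<N+1. (cmod (\<Sum>x\<in>S. b x * e x j))\<^sup>2)
      = (\<Sum>j<N+1. (\<Sum>x\<in>S. b x * e x j) * cnj (\<Sum>y\<in>S. b y * e y j))"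
    by (simp only: of_real_sum complex_norm_square)
  also have "\<dots> = (\<Sum>j<N+1. \<Sum>x\<in>S. \<Sum>y\<in>S. b x * cnj (b y) * (e x j * cnj (e y j)))"
    by (simp add: sum_product mult_ac del: sum.lessThan_Suc)
  also have "\<dots> = (\<Sum>x\<in>S. \<Sum>y\<in>S. b x * cnj (b y) * (\<Sum>j<N+1. e x j * cnj (e y j)))"
    unfolding sum_distrib_left
    by (subst sum.swap, rule sum.cong[OF refl], subst sum.swap, rule refl)
  also have "\<dots> = (\<Sum>x\<in>S. \<Sum>y\<in>S. if x = y then b x * cnj (b y) * of_nat (N+1) else 0)"
    by (intro sum.cong refl) (subst ee, auto)
  also have "\<dots> = (\<Sum>x\<in>S. b x * cnj (b x) * of_nat (N+1))"
    using fin by simp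
  also have "\<dots> = complex_of_real ((real N + 1) * (\<Sum>x\<in>S. (cmod (b x))\<^sup>2))"
    unfolding of_real_mult of_real_sum complex_norm_square sum_distrib_left
    by (simp add: mult_ac add.commute)
  finally show ?thesis unfolding e_def of_real_eq_iff .
qed

text \<open>A cosine is half the sum of an exponential and its conjugate. As \<open>b\<close> is
  complex, the conjugate half is the conjugate of the exponential sum with coefficients
  \<open>cnj (b x)\<close>, so Parseval is applied to \<open>b\<close> and to its conjugate. The
  shift \<open>a\<close> enters only through the unimodular factor
  \<open>cis (a * theta N j)\<close>.\<close>

lemma sum_cos_sq_bound:
  fixes b :: "int \<Rightarrow> complex"
  assumes S: "S \<subseteq> Gam N" and b: "\<And>x. x \<in> S \<Longrightarrow> cmod (b x) \<le> 1"
  shows "(\<Sum>j=1..N. (cmod (\<Sum>x\<in>S. b x * complex_of_real (cos ((2 * real_of_int x + a) * theta N j))))\<^sup>2)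
           \<le> (real N + 1)\<^sup>2"
proof -
  have fin: "finite S" by (rule finite_subset[OF S finite_Gam])
  define u where "u c j = (cmod (\<Sum>x\<in>S. c x * cis (2 * real_of_int x * theta N j)))\<^sup>2"
    for c :: "int \<Rightarrow> complex" and j
  have U: "(\<Sum>j=1..N. u c j) \<le> (real N + 1)\<^sup>2" if c: "\<And>x. x \<in> S \<Longrightarrow> cmod (c x) \<le> 1" for c
  proof -
    \<comment> \<open>The nonnegative term \<open>j = 0\<close> is added to complete the group of
      characters.\<close>
    have "(\<Sum>j=1..N. u c j) \<le> (\<Sum>j<N+1. u c j)"
      by (rule sum_mono2) (auto simp: u_def)
    also have "\<dots> = (real N + 1) * (\<Sum>x\<in>S. (cmod (c x))\<^sup>2)"
      unfolding u_def by (rule parseval_cyclic[OF S])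
    also have "(\<Sum>x\<in>S. (cmod (c x))\<^sup>2) \<le> (\<Sum>x\<in>S. 1)"
      using c by (intro sum_mono) (simp add: power_le_one)
    also have "(\<Sum>x\<in>S. 1) \<le> real N + 1"
      using card_mono[OF finite_Gam S] by simp
    finally show ?thesis by (simp add: power2_eq_square mult_left_mono)
  qed
  have pt: "(cmod (\<Sum>x\<in>S. b x * complex_of_real (cos ((2 * real_of_int x + a) * theta N j))))\<^sup>2
       \<le> (u b j + u (\<lambda>x. cnj (b x)) j) / 2" for j
  proof -
    define p where "p = (\<Sum>x\<in>S. b x * cis (2 * real_of_int x * theta N j))"
    define q where "q = (\<Sum>x\<in>S. cnj (b x) * cis (2 * real_of_int x * theta N j))"
    have "b x * complex_of_real (cos ((2 * real_of_int x + a) * theta N j))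
       = (cis (a * theta N j) * (b x * cis (2 * real_of_int x * theta N j))
          + cnj (cis (a * theta N j) * (cnj (b x) * cis (2 * real_of_int x * theta N j)))) / 2" for x
    proof -
      have ang: "(2 * real_of_int x + a) * theta N j = a * theta N j + 2 * real_of_int x * theta N j"
        by (simp only: distrib_right add.commute)
      have cos_cis: "complex_of_real (cos t) = (cis t + cnj (cis t)) / 2" for t
        by (simp add: complex_eq_iff)
      show ?thesis
        unfolding ang cos_cis cis_mult[symmetric]
        by (simp only: complex_cnj_mult complex_cnj_cnj times_divide_eq_right distrib_left mult_ac)
    qed
    then have "(\<Sum>x\<in>S. b x * complex_of_real (cos ((2 * real_of_int x + a) * theta N j)))
        = (cis (a * theta N j) * p + cnj (cis (a * theta N j) * q)) / 2"
      by (simp only: p_def q_def sum_distrib_left cnj_sum sum.distrib flip: sum_divide_distrib)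
    also have "cmod \<dots> \<le> (cmod p + cmod q) / 2"
      using norm_triangle_ineq[of "cis (a * theta N j) * p" "cnj (cis (a * theta N j) * q)"]
      by (simp add: norm_mult norm_divide)
    finally have "(cmod (\<Sum>x\<in>S. b x * complex_of_real (cos ((2 * real_of_int x + a) * theta N j))))\<^sup>2
        \<le> ((cmod p + cmod q) / 2)\<^sup>2"
      by (rule power_mono) simp
    also have "\<dots> \<le> ((cmod p)\<^sup>2 + (cmod q)\<^sup>2) / 2"
      using zero_le_power2[of "cmod p - cmod q"] by (simp add: power2_eq_square field_simps)
    finally show ?thesis by (simp add: u_def p_def q_def)
  qed
  have "(\<Sum>j=1..N. (cmod (\<Sum>x\<in>S. b x * complex_of_real (cos ((2 * real_of_int x + a) * theta N j))))\<^sup>2)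
      \<le> ((\<Sum>j=1..N. u b j) + (\<Sum>j=1..N. u (\<lambda>x. cnj (b x)) j)) / 2"
    unfolding sum.distrib[symmetric] sum_divide_distrib by (rule sum_mono[OF pt])
  also have "\<dots> \<le> (real N + 1)\<^sup>2"
    using U[of b] U[of "\<lambda>x. cnj (b x)"] b by simp
  finally show ?thesis .
qed

subsection \<open>Translates and band kernels\<close>

lemma L_subset: "L N z \<subseteq> Gam N"
  by (auto simp: L_def)

lemma finite_L [simp]: "finite (L N z)"
  by (rule finite_subset[OF L_subset finite_Gam])

lemma card_L: "real (card (L N z)) \<le> real N" "real N - real_of_int \<bar>z\<bar> \<le> real (card (L N z))"
proof -
  show "real (card (L N z)) \<le> real N"
    using card_mono[OF finite_Gam L_subset[of N z]] by simp
  \<comment> \<open>The interval has \<open>N - |z|\<close> points, or none once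
    \<open>|z| \<ge> N\<close>; in the latter case the lower bound is nonpositive.\<close>
  have "L N z = {max 1 (1 - z)..min (int N) (int N - z)}"
    by (auto simp: L_def Gam_def)
  then show "real N - real_of_int \<bar>z\<bar> \<le> real (card (L N z))" by simp
qed

text \<open>Here \<open>j\<close> is fixed and the position is summed over a full period, the
  reverse of the Parseval situation. The range of \<open>j\<close> ensures that \<open>N + 1\<close>
  does not divide it.\<close>

lemma sum_cis_theta:
  assumes j: "j \<in> {1..N}"
  shows "(\<Sum>x<N+1. cis (2 * real x * theta N j)) = 0"
proof -
  have "(\<Sum>x<N+1. cis (2 * real x * theta N j))
      = (\<Sum>x<N+1. cis (real_of_int (int j) * real x * (2 * pi / real (N+1))))"
    by (intro sum.cong refl arg_cong[where f=cis]) (simp add: theta_def field_simps)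
  also have "\<dots> = 0"
    using j by (subst sum_roots_of_unity) (auto dest: zdvd_imp_le)
  finally show ?thesis .
qed

text \<open>Over the full period \<open>0..N\<close> the sum vanishes, so it equals minus the sum
  over the points missing from \<open>L N z\<close>. There are at most \<open>|z| + 1\<close> of
  them, the extra one being \<open>x = 0\<close>, and each contributes at most 1 in modulus.\<close>

lemma sum_cos_L_bound:
  assumes j: "j \<in> {1..N}"
  shows "\<bar>\<Sum>x\<in>L N z. cos ((2 * real_of_int x + real_of_int z) * theta N j)\<bar> \<le> real_of_int \<bar>z\<bar> + 1"
proof -
  define f where "f x = cos ((2 * real_of_int x + real_of_int z) * theta N j)" for x :: int
  have sub: "L N z \<subseteq> int ` {..<N+1}"
  proof
    fix x assume "x \<in> L N z"
    then show "x \<in> int ` {..<N+1}" by (intro image_eqI[of _ _ "nat x"]) (auto simp: L_def Gam_def)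
  qed
  have "(\<Sum>x\<in>int ` {..<N+1}. f x) = Re (cis (real_of_int z * theta N j) * (\<Sum>x<N+1. cis (2 * real x * theta N j)))"
    unfolding sum_distrib_left cis_mult Re_sum
    by (subst sum.reindex) (auto simp: f_def algebra_simps inj_on_def)
  then have full: "(\<Sum>x\<in>int ` {..<N+1}. f x) = 0" unfolding sum_cis_theta[OF j] by simp
  have "(\<Sum>x\<in>L N z. f x) = - (\<Sum>x\<in>int ` {..<N+1} - L N z. f x)"
    using sum.subset_diff[OF sub, of f] full by simp
  then have "\<bar>\<Sum>x\<in>L N z. f x\<bar> \<le> (\<Sum>x\<in>int ` {..<N+1} - L N z. 1)"
    by (simp only: abs_minus_cancel) (rule order.trans[OF sum_abs], rule sum_mono, simp add: f_def)
  also have "\<dots> = real (card (int ` {..<N+1})) - real (card (L N z))"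
    using sub card_mono[OF _ sub] by (simp add: card_Diff_subset)
  also have "\<dots> \<le> real_of_int \<bar>z\<bar> + 1"
    using card_L(2)[of N z] by (subst card_image) (auto simp: inj_on_def)
  finally show ?thesis by (simp add: f_def)
qed

text \<open>Two errors of equal size give the factor 2: \<open>L N z\<close> falls short of the
  normalisation \<open>N + 1\<close> by at most \<open>|z| + 1\<close> points, and the oscillating
  sum is at most \<open>|z| + 1\<close>.\<close>

lemma ip_rho_s:
  assumes j: "j \<in> {1..N}"
  shows "cmod (ip N (s N j) (rho N z (s N j)) - complex_of_real (cos (real_of_int \<bar>z\<bar> * theta N j)))
           \<le> 2 * (real_of_int \<bar>z\<bar> + 1) / (real N + 1)"
proof -
  define c where "c = cos (real_of_int z * theta N j)"
  define E where "E = (\<Sum>x\<in>L N z. cos ((2 * real_of_int x + real_of_int z) * theta N j))"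
  define n where "n = real (card (L N z))"
  have cz: "cos (real_of_int \<bar>z\<bar> * theta N j) = c" by (simp add: c_def abs_if)
  have "ip N (s N j) (rho N z (s N j)) = (\<Sum>x\<in>L N z. s N j x * s N j (x + z))"
    unfolding ip_def rho_def by (rule sum.mono_neutral_cong_right) (auto simp: L_def)
  also have "\<dots> = (\<Sum>x\<in>L N z. complex_of_real
     ((c - cos ((2 * real_of_int x + real_of_int z) * theta N j)) / (real N + 1)))"
  proof (rule sum.cong[OF refl])
    fix x assume "x \<in> L N z"
    then have x: "x \<in> Gam N" "x + z \<in> Gam N" by (auto simp: L_def)
    have ang: "real_of_int (x + z - x) = real_of_int z"
      "real_of_int (x + (x + z)) = 2 * real_of_int x + real_of_int z" by auto
    show "s N j x * s N j (x + z) = complex_of_real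
      ((c - cos ((2 * real_of_int x + real_of_int z) * theta N j)) / (real N + 1))"
      unfolding s_mult_s[OF x] ang c_def ..
  qed
  also have "\<dots> = complex_of_real ((n * c - E) / (real N + 1))"
    unfolding of_real_sum[symmetric] sum_divide_distrib[symmetric] sum_subtractf E_def n_def by simp
  finally have "ip N (s N j) (rho N z (s N j)) - complex_of_real c
     = complex_of_real ((n * c - E) / (real N + 1) - c)" by simp
  also have "(n * c - E) / (real N + 1) - c = - ((real N + 1 - n) * c + E) / (real N + 1)"
    by (simp add: field_simps)
  finally have "cmod (ip N (s N j) (rho N z (s N j)) - complex_of_real c)
      = \<bar>- ((real N + 1 - n) * c + E) / (real N + 1)\<bar>"
    by (simp only: norm_of_real)
  also have "\<dots> = \<bar>(real N + 1 - n) * c + E\<bar> / (real N + 1)"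
    by (simp only: abs_divide abs_minus_cancel)
  also have "\<dots> \<le> 2 * (real_of_int \<bar>z\<bar> + 1) / (real N + 1)"
  proof (rule divide_right_mono)
    have "\<bar>real N + 1 - n\<bar> \<le> real_of_int \<bar>z\<bar> + 1"
      using card_L[of N z] unfolding n_def by linarith
    moreover have "\<bar>c\<bar> \<le> 1" by (simp add: c_def)
    ultimately have "\<bar>(real N + 1 - n) * c\<bar> \<le> (real_of_int \<bar>z\<bar> + 1) * 1"
      unfolding abs_mult by (rule mult_mono) auto
    then show "\<bar>(real N + 1 - n) * c + E\<bar> \<le> 2 * (real_of_int \<bar>z\<bar> + 1)"
      using abs_triangle_ineq[of "(real N + 1 - n) * c" E] sum_cos_L_bound[OF j, of z]
      unfolding E_def[symmetric] by argo
  qed simp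
  finally show ?thesis unfolding cz .
qed

section \<open>Variance over the spectrum for kernels supported in a band\<close>

text \<open>\<open>L N z\<close> parametrises the diagonal \<open>y = x + z\<close> of the square by
  \<open>x\<close>. The range of \<open>z\<close> is independent of \<open>N\<close>; diagonals that
  miss the square contribute empty sums.\<close>

lemma band_sum:
  fixes f :: "int \<Rightarrow> int \<Rightarrow> complex"
  assumes "\<And>x y. x \<in> Gam N \<Longrightarrow> y \<in> Gam N \<Longrightarrow> \<bar>x - y\<bar> > int R \<Longrightarrow> f x y = 0"
  shows "(\<Sum>x\<in>Gam N. \<Sum>y\<in>Gam N. f x y) = (\<Sum>z\<in>{- int R..int R}. \<Sum>x\<in>L N z. f x (x + z))"
proof -
  have "(\<Sum>x\<in>Gam N. \<Sum>y\<in>Gam N. f x y) = (\<Sum>(x, y)\<in>Gam N \<times> Gam N. f x y)"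
    by (rule sum.cartesian_product)
  also have "\<dots> = (\<Sum>(x, y)\<in>{(x, y). x \<in> Gam N \<and> y \<in> Gam N \<and> \<bar>x - y\<bar> \<le> int R}. f x y)"
    by (intro sum.mono_neutral_right) (auto, metis assms not_le)
  also have "\<dots> = (\<Sum>(z, x)\<in>(SIGMA z:{- int R..int R}. L N z). f x (x + z))"
    by (rule sum.reindex_bij_witness[where i = "\<lambda>(z, x). (x, x + z)" and j = "\<lambda>(x, y). (y - x, x)"])
       (auto simp: L_def)
  also have "\<dots> = (\<Sum>z\<in>{- int R..int R}. \<Sum>x\<in>L N z. f x (x + z))"
    by (subst sum.Sigma) auto
  finally show ?thesis .
qed

lemma ip_kernel_op:
  "ip N \<phi> (kernel_op N K \<phi>) = (\<Sum>x\<in>Gam N. \<Sum>y\<in>Gam N. K x y * (cnj (\<phi> x) * \<phi> y))"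
  unfolding ip_def kernel_op_def by (intro sum.cong refl) (simp add: sum_distrib_left mult_ac)

lemma cos_abs_theta: "cos (real_of_int \<bar>z\<bar> * t) = cos (real_of_int z * t)"
  by (simp add: abs_if)

lemma norm_diff_sq_le: "(norm (a - b))\<^sup>2 \<le> 2 * (norm a)\<^sup>2 + 2 * (norm b)\<^sup>2"
  for a b :: "'a :: real_normed_vector"
proof -
  have "(norm (a - b))\<^sup>2 \<le> (norm a + norm b)\<^sup>2"
    by (intro power_mono norm_triangle_ineq4) simp
  also have "\<dots> \<le> 2 * (norm a)\<^sup>2 + 2 * (norm b)\<^sup>2"
    using zero_le_power2[of "norm a - norm b"] by (simp add: power2_eq_square algebra_simps)
  finally show ?thesis .
qed

text \<open>The free weight \<open>w\<close> serves both \<open>1 / card (L N z)\<close> and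
  \<open>1 / N\<close>; its hypothesis bounds the change of mass along a diagonal relative to the
  weight \<open>1 / (N + 1)\<close> of the sines. In the constant, one factor
  \<open>2 * R + 1\<close> is from Cauchy-Schwarz and the other counts the diagonals, each of which
  contributes at most \<open>2 * (R + 1)^2 + 2\<close>.\<close>

lemma band_kernel_variance:
  assumes band: "\<And>x y. x \<in> Gam N \<Longrightarrow> y \<in> Gam N \<Longrightarrow> \<bar>x - y\<bar> > int R \<Longrightarrow> K x y = 0"
    and K: "\<And>x y. x \<in> Gam N \<Longrightarrow> y \<in> Gam N \<Longrightarrow> cmod (K x y) \<le> 1"
    and w: "\<And>z. \<bar>z\<bar> \<le> int R \<Longrightarrow>
        real (card (L N z)) * \<bar>1 / (real N + 1) - w z\<bar> \<le> (real R + 1) / (real N + 1)"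
  shows "(\<Sum>j=1..N. (cmod (ip N (s N j) (kernel_op N K (s N j))
           - (\<Sum>z\<in>{- int R..int R}. \<Sum>x\<in>L N z.
               complex_of_real (w z) * K x (x + z) * complex_of_real (cos (real_of_int \<bar>z\<bar> * theta N j)))))\<^sup>2)
       \<le> (2 * real R + 1)\<^sup>2 * (2 * (real R + 1)\<^sup>2 + 2)" (is "?lhs \<le> _")
proof -
  define Z where "Z = {- int R..int R}"
  define n where "n = real N + 1"
  have n: "n > 0" by (simp add: n_def)
  have cardZ: "real (card Z) = 2 * real R + 1" by (simp add: Z_def)
  \<comment> \<open>\<open>d\<close> collects the error in the weight, and \<open>e\<close> the
    oscillating cosines before division by \<open>n\<close>.\<close>
  define d where "d z j = (\<Sum>x\<in>L N z. complex_of_real (1 / n - w z) * K x (x + z) *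
      complex_of_real (cos (real_of_int z * theta N j)))" for z j
  define e where "e z j = (\<Sum>x\<in>L N z. K x (x + z) *
      complex_of_real (cos ((2 * real_of_int x + real_of_int z) * theta N j)))" for z j
  have diff: "ip N (s N j) (kernel_op N K (s N j))
       - (\<Sum>z\<in>Z. \<Sum>x\<in>L N z. complex_of_real (w z) * K x (x + z) *
            complex_of_real (cos (real_of_int \<bar>z\<bar> * theta N j)))
     = (\<Sum>z\<in>Z. d z j - e z j / complex_of_real n)" for j
  proof -
    have "ip N (s N j) (kernel_op N K (s N j))
       = (\<Sum>z\<in>Z. \<Sum>x\<in>L N z. K x (x + z) * (s N j x * s N j (x + z)))"
      unfolding ip_kernel_op cnj_s Z_def by (rule band_sum) (simp add: band)
    also have "\<dots> = (\<Sum>z\<in>Z. \<Sum>x\<in>L N z. K x (x + z) * complex_of_real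
        ((cos (real_of_int z * theta N j) - cos ((2 * real_of_int x + real_of_int z) * theta N j)) / n))"
    proof (intro sum.cong refl)
      fix z x assume "x \<in> L N z"
      then have x: "x \<in> Gam N" "x + z \<in> Gam N" by (auto simp: L_def)
      have ang: "real_of_int (x + z - x) = real_of_int z"
        "real_of_int (x + (x + z)) = 2 * real_of_int x + real_of_int z" by auto
      show "K x (x + z) * (s N j x * s N j (x + z)) = K x (x + z) * complex_of_real
        ((cos (real_of_int z * theta N j) - cos ((2 * real_of_int x + real_of_int z) * theta N j)) / n)"
        unfolding s_mult_s[OF x] ang n_def ..
    qed
    finally show ?thesis
      unfolding d_def e_def cos_abs_theta sum_subtractf[symmetric] sum_divide_distrib
      by (rule ssubst, unfold sum_subtractf[symmetric], intro sum.cong refl)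
         (simp add: algebra_simps diff_divide_distrib)
  qed
  have d: "cmod (d z j) \<le> (real R + 1) / n" if "z \<in> Z" for z j
  proof -
    have "cmod (d z j) \<le> (\<Sum>x\<in>L N z. \<bar>1 / n - w z\<bar>)"
      unfolding d_def
    proof (rule sum_norm_le)
      fix x assume "x \<in> L N z"
      then have "cmod (K x (x + z)) \<le> 1" by (intro K) (auto simp: L_def)
      then have "\<bar>1 / n - w z\<bar> * cmod (K x (x + z)) * \<bar>cos (real_of_int z * theta N j)\<bar>
          \<le> \<bar>1 / n - w z\<bar> * 1 * 1"
        by (intro mult_mono) auto
      then show "cmod (complex_of_real (1 / n - w z) * K x (x + z) *
          complex_of_real (cos (real_of_int z * theta N j))) \<le> \<bar>1 / n - w z\<bar>"
        by (simp only: norm_mult norm_of_real mult_1_right)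
    qed
    also have "\<dots> \<le> (real R + 1) / n"
      using w[of z] that by (simp add: Z_def n_def abs_le_iff)
    finally show ?thesis .
  qed
  have e: "(\<Sum>j=1..N. (cmod (e z j))\<^sup>2) \<le> n\<^sup>2" for z
    unfolding e_def n_def by (rule sum_cos_sq_bound[OF L_subset]) (auto simp: L_def intro: K)
  have "?lhs = (\<Sum>j=1..N. (cmod (\<Sum>z\<in>Z. d z j - e z j / complex_of_real n))\<^sup>2)"
    using diff by (simp only: Z_def)
  \<comment> \<open>Cauchy-Schwarz over the \<open>2 * R + 1\<close> diagonals, then the square of a
    difference is at most twice the sum of the squares.\<close>
  also have "\<dots> \<le> (\<Sum>j=1..N. (2 * real R + 1) * (\<Sum>z\<in>Z. 2 * ((real R + 1) / n)\<^sup>2 + 2 * (cmod (e z j))\<^sup>2 / n\<^sup>2))"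
  proof (rule sum_mono)
    fix j
    have "(cmod (\<Sum>z\<in>Z. d z j - e z j / complex_of_real n))\<^sup>2
        \<le> (\<Sum>z\<in>Z. cmod (d z j - e z j / complex_of_real n))\<^sup>2"
      by (intro power_mono norm_sum norm_ge_zero)
    also have "\<dots> \<le> (2 * real R + 1) * (\<Sum>z\<in>Z. (cmod (d z j - e z j / complex_of_real n))\<^sup>2)"
      using sum_squared_le_sum_of_squares[of "\<lambda>z. cmod (d z j - e z j / complex_of_real n)" Z]
      unfolding cardZ by (simp add: mult.commute)
    also have "\<dots> \<le> (2 * real R + 1) * (\<Sum>z\<in>Z. 2 * ((real R + 1) / n)\<^sup>2 + 2 * (cmod (e z j))\<^sup>2 / n\<^sup>2)"
    proof (intro mult_left_mono sum_mono)
      fix z assume "z \<in> Z"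
      then have "(cmod (d z j))\<^sup>2 \<le> ((real R + 1) / n)\<^sup>2"
        by (intro power_mono d) auto
      then show "(cmod (d z j - e z j / complex_of_real n))\<^sup>2
          \<le> 2 * ((real R + 1) / n)\<^sup>2 + 2 * (cmod (e z j))\<^sup>2 / n\<^sup>2"
        using norm_diff_sq_le[of "d z j" "e z j / complex_of_real n"]
        by (simp add: norm_divide power_divide)
    qed simp
    finally show "(cmod (\<Sum>z\<in>Z. d z j - e z j / complex_of_real n))\<^sup>2 \<le> \<dots>" .
  qed
  also have "\<dots> = (2 * real R + 1) * (\<Sum>z\<in>Z. \<Sum>j=1..N. 2 * ((real R + 1) / n)\<^sup>2 + 2 * (cmod (e z j))\<^sup>2 / n\<^sup>2)"
    unfolding sum_distrib_left[symmetric] by (subst sum.swap) (rule refl)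
  also have "\<dots> \<le> (2 * real R + 1) * (\<Sum>z\<in>Z. 2 * (real R + 1)\<^sup>2 + 2)"
  proof (intro mult_left_mono sum_mono)
    fix z
    have "(\<Sum>j=1..N. 2 * ((real R + 1) / n)\<^sup>2 + 2 * (cmod (e z j))\<^sup>2 / n\<^sup>2)
        = real N / n\<^sup>2 * (2 * (real R + 1)\<^sup>2) + 2 * (\<Sum>j=1..N. (cmod (e z j))\<^sup>2) / n\<^sup>2"
      by (simp add: sum.distrib power_divide flip: sum_divide_distrib sum_distrib_left)
    \<comment> \<open>The weight errors sum over \<open>j\<close> to order \<open>1 / N\<close>, of
      which only boundedness is kept.\<close>
    also have "real N / n\<^sup>2 * (2 * (real R + 1)\<^sup>2) \<le> 1 * (2 * (real R + 1)\<^sup>2)"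
    proof (rule mult_right_mono)
      have "real N \<le> n\<^sup>2" by (simp add: n_def power2_eq_square algebra_simps)
      then show "real N / n\<^sup>2 \<le> 1" using n by simp
    qed simp
    also have "2 * (\<Sum>j=1..N. (cmod (e z j))\<^sup>2) / n\<^sup>2 \<le> 2"
      using e[of z] n by (simp add: field_simps)
    finally show "(\<Sum>j=1..N. 2 * ((real R + 1) / n)\<^sup>2 + 2 * (cmod (e z j))\<^sup>2 / n\<^sup>2) \<le> 2 * (real R + 1)\<^sup>2 + 2"
      by simp
  qed simp
  also have "\<dots> = (2 * real R + 1)\<^sup>2 * (2 * (real R + 1)\<^sup>2 + 2)"
    by (simp add: cardZ power2_eq_square)
  finally show ?thesis .
qed

section \<open>From the variance bound to the two averages\<close>

text \<open>Half of \<open>lam N j\<close> is the cosine of an angle between 0 and \<pi>, where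
  \<open>arccos\<close> inverts cosine.\<close>

lemma Phi_lam:
  assumes "j \<in> {1..N}"
  shows "Phi (lam N j) (nat \<bar>z\<bar>) = cos (real_of_int \<bar>z\<bar> * theta N j)"
  using theta_range[OF assms] by (simp add: Phi_def lam_theta arccos_cos)

lemma tendsto_average_zero:
  fixes S :: "nat \<Rightarrow> real"
  assumes "\<And>N. N \<ge> 1 \<Longrightarrow> 0 \<le> S N" "\<And>N. N \<ge> 1 \<Longrightarrow> S N \<le> C"
  shows "(\<lambda>N. 1 / real N * S N) \<longlonglongrightarrow> 0"
proof (rule tendsto_sandwich[where f = "\<lambda>_. 0" and h = "\<lambda>N. C / real N"])
  show "(\<lambda>N. C / real N) \<longlonglongrightarrow> 0" by (rule lim_const_over_n)
  show "\<forall>\<^sub>F N in sequentially. 0 \<le> 1 / real N * S N"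
    using eventually_ge_at_top[of 1] by eventually_elim (use assms in auto)
  show "\<forall>\<^sub>F N in sequentially. 1 / real N * S N \<le> C / real N"
    using eventually_ge_at_top[of 1] by eventually_elim (use assms in \<open>auto simp: divide_right_mono\<close>)
qed auto

text \<open>The quadratic form contains \<open>c\<close> once and its conjugate once. This carries
  the bounds for the sines over to any eigenbasis.\<close>

lemma ip_kernel_op_phase:
  assumes "cmod c = 1"
  shows "ip N (\<lambda>x. c * \<phi> x) (kernel_op N K (\<lambda>x. c * \<phi> x)) = ip N \<phi> (kernel_op N K \<phi>)"
proof -
  have "cnj c * c = 1"
    using assms complex_norm_square[of c] by (simp add: mult.commute)
  then have "cnj (c * a) * (c * b) = cnj a * b" for a b
    by (metis complex_cnj_mult mult.assoc mult.left_commute mult_1)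
  then show ?thesis unfolding ip_kernel_op by (simp only:)
qed

text \<open>The band restricts the sum to \<open>|z| \<le> R\<close>, and the weight is
  \<open>1 / card (L N z)\<close>. Multiplied by the length of a nonempty diagonal, its distance
  from \<open>1 / (N + 1)\<close> is the number of missing points, at most \<open>R + 1\<close>,
  over \<open>N + 1\<close>.\<close>

lemma ip_kernel_vs_local_average:
  assumes band: "\<forall>x\<in>Gam N. \<forall>y\<in>Gam N. \<bar>x - y\<bar> > int R \<longrightarrow> K x y = 0"
    and K: "\<forall>x\<in>Gam N. \<forall>y\<in>Gam N. cmod (K x y) \<le> 1"
  shows "(\<Sum>j=1..N. (cmod (ip N (s N j) (kernel_op N K (s N j))
           - (\<Sum>z\<in>{z. L N z \<noteq> {}}. \<Sum>x\<in>L N z. 1 / of_nat (card (L N z)) * K x (x + z) *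
               complex_of_real (cos (real_of_int \<bar>z\<bar> * real j * pi / (real N + 1))))))\<^sup>2)
       \<le> (2 * real R + 1)\<^sup>2 * (2 * (real R + 1)\<^sup>2 + 2)"
proof -
  define f where "f j z x = complex_of_real (1 / real (card (L N z))) * K x (x + z) *
      complex_of_real (cos (real_of_int \<bar>z\<bar> * theta N j))" for j z x
  have "{z. L N z \<noteq> {}} \<subseteq> {- int N..int N}"
    by (auto simp: L_def Gam_def)
  then have fin: "finite {z. L N z \<noteq> {}}" by (rule finite_subset) simp
  have f0: "f j z x = 0" if "\<bar>z\<bar> > int R" "x \<in> L N z" for j z x
    using band that by (auto simp: f_def L_def)
  have "(\<Sum>z\<in>{z. L N z \<noteq> {}}. \<Sum>x\<in>L N z. 1 / of_nat (card (L N z)) * K x (x + z) *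
           complex_of_real (cos (real_of_int \<bar>z\<bar> * real j * pi / (real N + 1))))
       = (\<Sum>z\<in>{z. L N z \<noteq> {}}. \<Sum>x\<in>L N z. f j z x)" for j
    by (simp add: f_def theta_def mult.assoc)
  also have "\<dots> j = (\<Sum>z\<in>{- int R..int R}. \<Sum>x\<in>L N z. f j z x)" for j
    by (rule sum.mono_neutral_cong) (auto simp: fin intro!: sum.neutral f0)
  finally have eq: "(\<Sum>z\<in>{z. L N z \<noteq> {}}. \<Sum>x\<in>L N z. 1 / of_nat (card (L N z)) * K x (x + z) *
           complex_of_real (cos (real_of_int \<bar>z\<bar> * real j * pi / (real N + 1))))
       = (\<Sum>z\<in>{- int R..int R}. \<Sum>x\<in>L N z. f j z x)" for j .
  show ?thesis
    unfolding eq f_def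
  proof (rule band_kernel_variance[where N = N and K = K])
    fix z :: int assume z: "\<bar>z\<bar> \<le> int R"
    show "real (card (L N z)) * \<bar>1 / (real N + 1) - 1 / real (card (L N z))\<bar> \<le> (real R + 1) / (real N + 1)"
    \<comment> \<open>An empty diagonal makes the leading factor zero, whatever the value of
      \<open>1 / 0\<close>.\<close>
    proof (cases "card (L N z) = 0")
      case False
      then have "real (card (L N z)) * \<bar>1 / (real N + 1) - 1 / real (card (L N z))\<bar>
          = \<bar>real (card (L N z)) * (1 / (real N + 1) - 1 / real (card (L N z)))\<bar>"
        by (simp add: abs_mult)
      also have "real (card (L N z)) * (1 / (real N + 1) - 1 / real (card (L N z)))
          = (real (card (L N z)) - (real N + 1)) / (real N + 1)"
        using False by (simp add: right_diff_distrib diff_divide_distrib)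
      also have "\<bar>\<dots>\<bar> = \<bar>real (card (L N z)) - (real N + 1)\<bar> / (real N + 1)"
        by (simp add: abs_divide)
      also have "\<dots> \<le> (real R + 1) / (real N + 1)"
        using card_L[of N z] z by (intro divide_right_mono) auto
      finally show ?thesis .
    qed simp
  qed (use band K in auto)
qed

text \<open>Grouped by diagonals, the average has the constant weight \<open>1 / N\<close>. A
  diagonal has at most \<open>N\<close> points, and \<open>N\<close> times
  \<open>1 / N - 1 / (N + 1)\<close> is \<open>1 / (N + 1)\<close>.\<close>

lemma ip_kernel_vs_kernel_avg:
  assumes N: "N \<ge> 1"
    and band: "\<forall>x\<in>Gam N. \<forall>y\<in>Gam N. \<bar>x - y\<bar> > int R \<longrightarrow> K x y = 0"
    and K: "\<forall>x\<in>Gam N. \<forall>y\<in>Gam N. cmod (K x y) \<le> 1"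
  shows "(\<Sum>j=1..N. (cmod (ip N (s N j) (kernel_op N K (s N j)) - kernel_avg N K (lam N j)))\<^sup>2)
       \<le> (2 * real R + 1)\<^sup>2 * (2 * (real R + 1)\<^sup>2 + 2)"
proof -
  have eq: "kernel_avg N K (lam N j) = (\<Sum>z\<in>{- int R..int R}. \<Sum>x\<in>L N z.
      complex_of_real (1 / real N) * K x (x + z) * complex_of_real (cos (real_of_int \<bar>z\<bar> * theta N j)))"
    if j: "j \<in> {1..N}" for j
  proof -
    have "kernel_avg N K (lam N j) = (\<Sum>x\<in>Gam N. \<Sum>y\<in>Gam N. complex_of_real (1 / real N) * K x y *
        complex_of_real (cos (real_of_int \<bar>x - y\<bar> * theta N j)))"
      unfolding kernel_avg_def Phi_lam[OF j] by (simp add: sum_distrib_left mult.assoc)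
    also have "\<dots> = (\<Sum>z\<in>{- int R..int R}. \<Sum>x\<in>L N z.
      complex_of_real (1 / real N) * K x (x + z) * complex_of_real (cos (real_of_int \<bar>x - (x + z)\<bar> * theta N j)))"
      by (rule band_sum) (use band in auto)
    finally show ?thesis by simp
  qed
  have "(\<Sum>j=1..N. (cmod (ip N (s N j) (kernel_op N K (s N j)) - kernel_avg N K (lam N j)))\<^sup>2)
     = (\<Sum>j=1..N. (cmod (ip N (s N j) (kernel_op N K (s N j)) - (\<Sum>z\<in>{- int R..int R}. \<Sum>x\<in>L N z.
      complex_of_real (1 / real N) * K x (x + z) * complex_of_real (cos (real_of_int \<bar>z\<bar> * theta N j)))))\<^sup>2)"
    by (intro sum.cong refl) (simp only: eq)
  also have "\<dots> \<le> (2 * real R + 1)\<^sup>2 * (2 * (real R + 1)\<^sup>2 + 2)"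
  proof (rule band_kernel_variance[where N = N and K = K])
    fix z :: int
    have "real (card (L N z)) * \<bar>1 / (real N + 1) - 1 / real N\<bar> \<le> real N * \<bar>1 / (real N + 1) - 1 / real N\<bar>"
      using card_L(1)[of N z] by (intro mult_right_mono) auto
    also have "\<dots> = 1 / (real N + 1)"
    proof -
      have "1 / (real N + 1) - 1 / real N = - (1 / (real N * (real N + 1)))"
        using N by (simp add: field_simps)
      then show ?thesis using N by simp
    qed
    also have "\<dots> \<le> (real R + 1) / (real N + 1)"
      by (intro divide_right_mono) auto
    finally show "real (card (L N z)) * \<bar>1 / (real N + 1) - 1 / real N\<bar> \<le> (real R + 1) / (real N + 1)" .
  qed (use band K in auto)
  finally show ?thesis .
qed

subsection \<open>The eigenbasis\<close>

lemma s_l2: "s N j \<in> l2 N"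
  by (simp add: l2_def s_def)

text \<open>The sine vanishes at \<open>0\<close> and \<open>N + 1\<close>, in agreement with the
  extension by zero. This is the Dirichlet condition; it spares the eigenvalue equation a separate
  treatment of the endpoints.\<close>

lemma s_extended:
  assumes "0 \<le> x" "x \<le> int N + 1"
  shows "s N j x = complex_of_real (sqrt (2 / (real N + 1)) * sin (real_of_int x * theta N j))"
proof -
  consider "x \<in> Gam N" | "x = 0" | "x = int N + 1"
    using assms by (force simp: Gam_def)
  then show ?thesis
  proof cases
    case 1
    then show ?thesis by (rule s_theta)
  next
    case 3
    have "real_of_int (int N + 1) * theta N j = real j * pi"
      by (simp add: theta_def)
    then show ?thesis using 3 by (simp add: s_def Gam_def)
  qed (simp add: s_def Gam_def)
qed

text \<open>On functions extended by zero the truncation is invisible: a neighbour outside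
  \<open>Gam N\<close> contributes nothing.\<close>

lemma adjacency_neighbours:
  assumes "\<psi> \<in> l2 N" "x \<in> Gam N"
  shows "adjacency N \<psi> x = \<psi> (x - 1) + \<psi> (x + 1)"
proof -
  have "adjacency N \<psi> x = (\<Sum>y\<in>{y \<in> Gam N. \<bar>y - x\<bar> = 1}. \<psi> y)"
    using assms by (simp add: adjacency_def)
  also have "\<dots> = (\<Sum>y\<in>{x - 1, x + 1}. \<psi> y)"
    using assms by (intro sum.mono_neutral_left) (auto simp: l2_def abs_if split: if_splits)
  finally show ?thesis by simp
qed

lemma adjacency_s:
  "adjacency N (s N j) = (\<lambda>x. complex_of_real (lam N j) * s N j x)"
proof
  fix x
  show "adjacency N (s N j) x = complex_of_real (lam N j) * s N j x"
  proof (cases "x \<in> Gam N")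
    case True
    then have x: "1 \<le> x" "x \<le> int N" by (auto simp: Gam_def)
    have "sin (real_of_int (x - 1) * theta N j) + sin (real_of_int (x + 1) * theta N j)
        = lam N j * sin (real_of_int x * theta N j)"
      by (simp add: lam_theta left_diff_distrib distrib_right sin_add sin_diff)
    then show ?thesis
      using x True unfolding adjacency_neighbours[OF s_l2 True]
      by (simp add: s_extended flip: of_real_mult of_real_add distrib_left)
  qed (simp add: adjacency_def s_def)
qed

text \<open>The neighbour relation is symmetric, so swapping the two summations moves the operator
  across.\<close>

lemma adjacency_selfadjoint: "ip N (adjacency N \<phi>) \<psi> = ip N \<phi> (adjacency N \<psi>)"
proof -
  have adj: "adjacency N f x = (\<Sum>y\<in>Gam N. if \<bar>y - x\<bar> = 1 then f y else 0)" if "x \<in> Gam N" for f x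
    using that by (simp add: adjacency_def sum.inter_filter)
  have "ip N (adjacency N \<phi>) \<psi> = (\<Sum>x\<in>Gam N. \<Sum>y\<in>Gam N. if \<bar>y - x\<bar> = 1 then cnj (\<phi> y) * \<psi> x else 0)"
    unfolding ip_def
    by (intro sum.cong refl) (auto simp: adj sum_distrib_right if_distrib intro!: sum.cong)
  also have "\<dots> = (\<Sum>y\<in>Gam N. \<Sum>x\<in>Gam N. if \<bar>y - x\<bar> = 1 then cnj (\<phi> y) * \<psi> x else 0)"
    by (rule sum.swap)
  also have "\<dots> = ip N \<phi> (adjacency N \<psi>)"
    unfolding ip_def
    by (intro sum.cong refl) (auto simp: adj sum_distrib_left abs_minus_commute intro!: sum.cong)
  finally show ?thesis .
qed

lemma Gam_eq: "Gam N = int ` {1..N}"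
  by (simp add: Gam_def image_int_atLeastAtMost)

lemma sum_Gam: "(\<Sum>x\<in>Gam N. f x) = (\<Sum>k=1..N. f (int k))"
  unfolding Gam_eq by (subst sum.reindex) (auto simp: inj_on_def)

text \<open>The cosines sum to zero over a full period, hence to -1 without \<open>x = 0\<close>,
  which leaves \<open>(N + 1) / (N + 1)\<close>. This explains the factor \<open>2 / (N + 1)\<close>
  under the root in \<open>s\<close>.\<close>

lemma ip_s_self:
  assumes j: "j \<in> {1..N}"
  shows "ip N (s N j) (s N j) = 1"
proof -
  have "0 = Re (\<Sum>x<N+1. cis (2 * real x * theta N j))"
    using sum_cis_theta[OF j] by simp
  also have "\<dots> = (\<Sum>x<N+1. cos (2 * real x * theta N j))" by simp
  also have "{..<N+1} = insert 0 {1..N}" by auto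
  finally have C: "(\<Sum>x=1..N. cos (2 * real x * theta N j)) = -1" by simp
  have "ip N (s N j) (s N j) = (\<Sum>x=1..N. s N j (int x) * s N j (int x))"
    unfolding ip_def sum_Gam by simp
  also have "\<dots> = (\<Sum>x=1..N. complex_of_real ((1 - cos (2 * real x * theta N j)) / (real N + 1)))"
    by (intro sum.cong refl) (subst s_mult_s, auto simp: Gam_def)
  also have "\<dots> = complex_of_real ((real N - (\<Sum>x=1..N. cos (2 * real x * theta N j))) / (real N + 1))"
    unfolding of_real_sum[symmetric] sum_divide_distrib[symmetric] sum_subtractf by simp
  also have "\<dots> = 1" unfolding C by (simp add: add.commute)
  finally show ?thesis .
qed

lemma ip_scale_left: "ip N (\<lambda>x. c * \<phi> x) \<psi> = cnj c * ip N \<phi> \<psi>"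
  by (simp add: ip_def sum_distrib_left mult.assoc)

lemma ip_scale_right: "ip N \<phi> (\<lambda>x. c * \<psi> x) = c * ip N \<phi> \<psi>"
  by (simp add: ip_def sum_distrib_left mult_ac)

text \<open>Self-adjointness gives \<open>(lam N i - \<mu>) * ip N (s N i) \<phi> = 0\<close>. It
  serves for the orthogonality of the sines and again for arbitrary eigenvectors.\<close>

lemma ip_s_eigenvector:
  assumes "adjacency N \<phi> = (\<lambda>x. \<mu> * \<phi> x)" "ip N (s N i) \<phi> \<noteq> 0"
  shows "\<mu> = complex_of_real (lam N i)"
proof -
  have "complex_of_real (lam N i) * ip N (s N i) \<phi> = \<mu> * ip N (s N i) \<phi>"
    using adjacency_selfadjoint[of N "s N i" \<phi>]
    unfolding adjacency_s assms(1) ip_scale_left ip_scale_right by simp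
  then show ?thesis using assms(2) by simp
qed

lemma ip_s_s:
  assumes "i \<in> {1..N}" "j \<in> {1..N}"
  shows "ip N (s N i) (s N j) = (if i = j then 1 else 0)"
proof (cases "i = j")
  case False
  have "ip N (s N i) (s N j) = 0"
  proof (rule ccontr)
    assume "ip N (s N i) (s N j) \<noteq> 0"
    then have "lam N j = lam N i"
      using ip_s_eigenvector[OF adjacency_s] of_real_eq_iff by blast
    then show False using lam_eq_iff[OF assms] False by simp
  qed
  then show ?thesis using False by simp
qed (use assms ip_s_self in simp)

text \<open>
  The matrix \<open>(s N j k)\<close> is symmetric, so orthonormality of its columns is orthonormality of
  its rows, which is completeness.
\<close>

lemma sum_s_s:
  assumes "x \<in> Gam N" "y \<in> Gam N"
  shows "(\<Sum>j=1..N. s N j x * s N j y) = (if x = y then 1 else 0)"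
proof -
  obtain a b where ab: "x = int a" "y = int b" "a \<in> {1..N}" "b \<in> {1..N}"
    using assms unfolding Gam_eq by blast
  have "(\<Sum>j=1..N. s N j x * s N j y) = (\<Sum>j=1..N. s N a (int j) * s N b (int j))"
    unfolding ab(1,2) by (intro sum.cong refl arg_cong2[where f = "(*)"] s_commute ab(3,4))
  also have "\<dots> = ip N (s N a) (s N b)"
    unfolding ip_def sum_Gam by simp
  finally show ?thesis using ab by (simp add: ip_s_s)
qed

lemma s_expansion:
  assumes "\<phi> \<in> l2 N"
  shows "\<phi> = (\<lambda>x. \<Sum>j=1..N. ip N (s N j) \<phi> * s N j x)"
proof
  fix x
  show "\<phi> x = (\<Sum>j=1..N. ip N (s N j) \<phi> * s N j x)"
  proof (cases "x \<in> Gam N")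
    case True
    have "(\<Sum>j=1..N. ip N (s N j) \<phi> * s N j x) = (\<Sum>j=1..N. \<Sum>y\<in>Gam N. \<phi> y * (s N j y * s N j x))"
      by (simp add: ip_def sum_distrib_left mult_ac)
    also have "\<dots> = (\<Sum>y\<in>Gam N. \<phi> y * (\<Sum>j=1..N. s N j y * s N j x))"
      unfolding sum_distrib_left by (rule sum.swap)
    also have "\<dots> = (\<Sum>y\<in>Gam N. if y = x then \<phi> y else 0)"
      using True by (intro sum.cong refl) (subst sum_s_s, auto)
    also have "\<dots> = \<phi> x" using True by simp
    finally show ?thesis by simp
  qed (use assms in \<open>simp add: l2_def s_def\<close>)
qed

lemma s_orthonormal_eigenbasis:
  "orthonormal_eigenbasis N (adjacency N) (\<lambda>j. complex_of_real (lam N j)) (s N)"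
  unfolding orthonormal_eigenbasis_def
proof (intro conjI ballI)
  fix \<phi> assume "\<phi> \<in> l2 N"
  then show "\<exists>c. \<phi> = (\<lambda>x. \<Sum>j=1..N. c j * s N j x)"
    by (intro exI[of _ "\<lambda>j. ip N (s N j) \<phi>"] s_expansion)
qed (simp_all only: s_l2 adjacency_s ip_s_s)

section \<open>Arbitrary eigenvectors and eigenbases\<close>

text \<open>Some coefficient in the sine basis is nonzero and determines \<mu>. As the eigenvalues
  are distinct, all other coefficients vanish, and the unit norm makes the surviving one
  unimodular.\<close>

lemma unit_eigenvector_cases:
  assumes l2: "\<phi> \<in> l2 N" and eig: "adjacency N \<phi> = (\<lambda>x. \<mu> * \<phi> x)" and unit: "ip N \<phi> \<phi> = 1"
  obtains i c where "i \<in> {1..N}" "cmod c = 1" "\<phi> = (\<lambda>x. c * s N i x)" "\<mu> = complex_of_real (lam N i)"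
proof -
  have "\<exists>i\<in>{1..N}. ip N (s N i) \<phi> \<noteq> 0"
  proof (rule ccontr)
    assume "\<not> ?thesis"
    then have "\<phi> = (\<lambda>x. 0)" using s_expansion[OF l2] by simp
    then show False using unit by (simp add: ip_def)
  qed
  then obtain i where i: "i \<in> {1..N}" "ip N (s N i) \<phi> \<noteq> 0" by blast
  define c where "c = ip N (s N i) \<phi>"
  have \<mu>: "\<mu> = complex_of_real (lam N i)" by (rule ip_s_eigenvector[OF eig i(2)])
  have other: "ip N (s N k) \<phi> = 0" if "k \<in> {1..N}" "k \<noteq> i" for k
  proof (rule ccontr)
    assume "ip N (s N k) \<phi> \<noteq> 0"
    then have "lam N k = lam N i" using ip_s_eigenvector[OF eig] \<mu> by (metis of_real_eq_iff)
    then show False using lam_eq_iff[OF that(1) i(1)] that(2) by simp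
  qed
  have \<phi>: "\<phi> = (\<lambda>x. c * s N i x)"
  proof
    fix x
    have "\<phi> x = (\<Sum>k=1..N. ip N (s N k) \<phi> * s N k x)" using s_expansion[OF l2] by (rule fun_cong)
    also have "\<dots> = (\<Sum>k=1..N. if k = i then c * s N i x else 0)"
      by (intro sum.cong refl) (auto simp: other c_def)
    also have "\<dots> = c * s N i x" using i(1) by simp
    finally show "\<phi> x = c * s N i x" .
  qed
  have "cnj c * c = 1"
    using unit unfolding \<phi> ip_scale_left ip_scale_right ip_s_self[OF i(1)] by simp
  then have "complex_of_real ((cmod c)\<^sup>2) = 1"
    unfolding complex_norm_square by (simp only: mult.commute)
  then have "cmod c = 1"
    by (metis norm_ge_zero of_real_eq_1_iff power2_eq_1_iff abs_of_nonneg abs_minus_cancel abs_one)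
  then show ?thesis using that i(1) \<phi> \<mu> by blast
qed

text \<open>Each basis vector is a phase times one sine. Two vectors sharing a sine would have an
  inner product of modulus 1 instead of 0, so \<open>\<sigma>\<close> is injective and hence a
  permutation.\<close>

lemma eigenbasis_unique:
  assumes "orthonormal_eigenbasis N (adjacency N) \<mu> \<psi>"
  shows "\<exists>\<sigma> c. bij_betw \<sigma> {1..N} {1..N} \<and>
    (\<forall>j\<in>{1..N}. cmod (c j) = 1 \<and> \<psi> j = (\<lambda>x. c j * s N (\<sigma> j) x) \<and>
       \<mu> j = complex_of_real (lam N (\<sigma> j)))"
proof -
  have basis: "\<psi> j \<in> l2 N" "adjacency N (\<psi> j) = (\<lambda>x. \<mu> j * \<psi> j x)" if "j \<in> {1..N}" for j
    using assms that by (auto simp: orthonormal_eigenbasis_def)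
  have orth: "ip N (\<psi> i) (\<psi> j) = (if i = j then 1 else 0)" if "i \<in> {1..N}" "j \<in> {1..N}" for i j
    using assms that by (auto simp: orthonormal_eigenbasis_def)
  have "\<forall>j\<in>{1..N}. \<exists>i c. i \<in> {1..N} \<and> cmod c = 1 \<and> \<psi> j = (\<lambda>x. c * s N i x) \<and>
      \<mu> j = complex_of_real (lam N i)"
  proof
    fix j assume j: "j \<in> {1..N}"
    have "ip N (\<psi> j) (\<psi> j) = 1" using orth[OF j j] by simp
    from unit_eigenvector_cases[OF basis[OF j] this]
    show "\<exists>i c. i \<in> {1..N} \<and> cmod c = 1 \<and> \<psi> j = (\<lambda>x. c * s N i x) \<and> \<mu> j = complex_of_real (lam N i)"
      by metis
  qed
  then obtain \<sigma> c where \<sigma>: "\<forall>j\<in>{1..N}. \<sigma> j \<in> {1..N} \<and> cmod (c j) = 1 \<and>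
      \<psi> j = (\<lambda>x. c j * s N (\<sigma> j) x) \<and> \<mu> j = complex_of_real (lam N (\<sigma> j))"
    by metis
  have "inj_on \<sigma> {1..N}"
  proof (rule inj_onI, rule ccontr)
    fix i j assume ij: "i \<in> {1..N}" "j \<in> {1..N}" "\<sigma> i = \<sigma> j" "i \<noteq> j"
    have eqs: "\<psi> i = (\<lambda>x. c i * s N (\<sigma> j) x)" "\<psi> j = (\<lambda>x. c j * s N (\<sigma> j) x)"
      using \<sigma> ij by metis+
    have "\<sigma> j \<in> {1..N}" using \<sigma> ij by blast
    then have "ip N (\<psi> i) (\<psi> j) = cnj (c i) * c j"
      unfolding eqs ip_scale_left ip_scale_right by (simp add: ip_s_self)
    moreover have "cmod (c i) = 1" "cmod (c j) = 1" using \<sigma> ij by blast+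
    ultimately show False using orth[OF ij(1,2)] ij(4) by auto
  qed
  moreover have "\<sigma> ` {1..N} \<subseteq> {1..N}" using \<sigma> by blast
  ultimately have "bij_betw \<sigma> {1..N} {1..N}"
    by (simp add: bij_betw_def endo_inj_surj)
  then show ?thesis using \<sigma> by blast
qed

text \<open>Prescribing the order of the distinct eigenvalues forces the permutation to fix every
  \<open>j\<close>.\<close>

lemma eigenbasis_lam_phase:
  assumes "orthonormal_eigenbasis N (adjacency N) (\<lambda>j. complex_of_real (lam N j)) \<psi>" "j \<in> {1..N}"
  shows "\<exists>c. cmod c = 1 \<and> \<psi> j = (\<lambda>x. c * s N j x)"
proof -
  obtain \<sigma> c where bij: "bij_betw \<sigma> {1..N} {1..N}"
    and c: "\<forall>j\<in>{1..N}. cmod (c j) = 1 \<and> \<psi> j = (\<lambda>x. c j * s N (\<sigma> j) x) \<and>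
       complex_of_real (lam N j) = complex_of_real (lam N (\<sigma> j))"
    using eigenbasis_unique[OF assms(1)] by blast
  have "\<sigma> j \<in> {1..N}" using bij assms(2) by (rule bij_betw_apply)
  moreover have "lam N j = lam N (\<sigma> j)" using c assms(2) of_real_eq_iff by blast
  ultimately have "\<sigma> j = j" using lam_eq_iff[OF assms(2)] by metis
  then show ?thesis using c assms(2) by metis
qed

section \<open>Diagonalisation and algebraic multiplicity\<close>

lemma adjacency_sum:
  assumes "finite A"
  shows "adjacency N (\<lambda>y. \<Sum>j\<in>A. c j * f j y) x = (\<Sum>j\<in>A. c j * adjacency N (f j) x)"
proof (cases "x \<in> Gam N")
  case True
  have "(\<Sum>y\<in>{y \<in> Gam N. \<bar>y - x\<bar> = 1}. \<Sum>j\<in>A. c j * f j y)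
      = (\<Sum>j\<in>A. \<Sum>y\<in>{y \<in> Gam N. \<bar>y - x\<bar> = 1}. c j * f j y)"
    by (rule sum.swap)
  then show ?thesis using True by (simp add: adjacency_def sum_distrib_left)
qed (simp add: adjacency_def)

text \<open>Expanding the point mass in sines turns the matrix entries into their spectral
  decomposition.\<close>

lemma adjacency_point_mass:
  assumes y: "y \<in> Gam N"
  shows "adjacency N (\<lambda>u. if u = y then 1 else 0) x
       = (\<Sum>j=1..N. s N j x * complex_of_real (lam N j) * s N j y)"
proof -
  have eq: "(\<lambda>u. if u = y then 1 else 0) = (\<lambda>u. \<Sum>j=1..N. s N j y * s N j u)"
  proof
    fix u
    show "(if u = y then 1 else 0) = (\<Sum>j=1..N. s N j y * s N j u)"
    proof (cases "u \<in> Gam N")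
      case True
      then show ?thesis using sum_s_s[OF y True] by auto
    next
      case False
      then show ?thesis using y by (auto simp: s_def)
    qed
  qed
  show ?thesis
    unfolding eq adjacency_sum[OF finite_atLeastAtMost] adjacency_s by (simp only: mult_ac)
qed

text \<open>The sine matrix \<open>S\<close> is symmetric and orthogonal, so
  \<open>S * D * S\<close> is a similarity to a diagonal matrix. The whole polynomial is computed
  because its roots carry the algebraic multiplicities.\<close>

lemma char_poly_adjacency:
  "char_poly (op_mat N (adjacency N)) = (\<Prod>\<mu>\<in>(\<lambda>j. complex_of_real (lam N j)) ` {1..N}. [:- \<mu>, 1:])"
proof -
  \<comment> \<open>Row index \<open>i\<close> stands for the point \<open>i + 1\<close>, column
    index \<open>k\<close> for the eigenfunction \<open>k + 1\<close>.\<close>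
  define S where "S = mat N N (\<lambda>(i, k). s N (Suc k) (int i + 1))"
  define D where "D = mat N N (\<lambda>(i, k). if i = k then complex_of_real (lam N (Suc k)) else 0)"
  have carrier: "S \<in> carrier_mat N N" "D \<in> carrier_mat N N" "op_mat N (adjacency N) \<in> carrier_mat N N"
    by (auto simp: S_def D_def op_mat_def)
  have shift: "(\<Sum>l = 0..<N. f (Suc l)) = (\<Sum>j=1..N. f j)" for f :: "nat \<Rightarrow> complex"
    using sum.shift_bounds_Suc_ivl[of f 0 N] by (simp add: atLeastLessThanSuc_atLeastAtMost)
  \<comment> \<open>Either index can be read as position or as frequency, so \<open>S\<close> also
    acts as its own transpose.\<close>
  have S_entry: "S $$ (i, k) = s N (Suc k) (int i + 1)" "S $$ (i, k) = s N (Suc i) (int k + 1)"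
    if "i < N" "k < N" for i k
    using that s_commute[of "Suc k" N "Suc i"] by (auto simp: S_def add.commute)
  have SS: "S * S = 1\<^sub>m N"
  proof (rule eq_matI)
    fix i k assume "i < dim_row (1\<^sub>m N :: complex mat)" "k < dim_col (1\<^sub>m N :: complex mat)"
    then have ik: "i < N" "k < N" by auto
    have "(S * S) $$ (i, k) = (\<Sum>l = 0..<N. S $$ (i, l) * S $$ (l, k))"
      using ik carrier by (simp add: scalar_prod_def)
    also have "\<dots> = (\<Sum>l = 0..<N. s N (Suc l) (int i + 1) * s N (Suc l) (int k + 1))"
      using ik by (intro sum.cong refl arg_cong2[where f = "(*)"] S_entry) auto
    also have "\<dots> = (\<Sum>j=1..N. s N j (int i + 1) * s N j (int k + 1))" by (rule shift)
    also have "\<dots> = 1\<^sub>m N $$ (i, k)" using ik by (subst sum_s_s) (auto simp: Gam_def)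
    finally show "(S * S) $$ (i, k) = 1\<^sub>m N $$ (i, k)" .
  qed (use carrier in auto)
  have "op_mat N (adjacency N) = S * D * S"
  proof (rule eq_matI)
    fix i k assume "i < dim_row (S * D * S)" "k < dim_col (S * D * S)"
    then have ik: "i < N" "k < N" using carrier by auto
    have SD: "(S * D) $$ (i, l) = S $$ (i, l) * complex_of_real (lam N (Suc l))" if l: "l < N" for l
    proof -
      have "(S * D) $$ (i, l) = (\<Sum>m = 0..<N. S $$ (i, m) * D $$ (m, l))"
        using ik l carrier by (simp add: scalar_prod_def)
      also have "\<dots> = (\<Sum>m = 0..<N. if m = l then S $$ (i, l) * complex_of_real (lam N (Suc l)) else 0)"
        using l by (intro sum.cong refl) (auto simp: D_def)
      also have "\<dots> = S $$ (i, l) * complex_of_real (lam N (Suc l))" using l by simp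
      finally show ?thesis .
    qed
    have "(S * D * S) $$ (i, k) = (\<Sum>l = 0..<N. (S * D) $$ (i, l) * S $$ (l, k))"
      using ik carrier by (simp add: scalar_prod_def del: assoc_mult_mat)
    also have "\<dots> = (\<Sum>l = 0..<N. s N (Suc l) (int i + 1) * complex_of_real (lam N (Suc l)) * s N (Suc l) (int k + 1))"
      using ik by (intro sum.cong refl) (auto simp: SD S_entry(1)[OF ik(1)] S_entry(2)[OF _ ik(2)])
    also have "\<dots> = (\<Sum>j=1..N. s N j (int i + 1) * complex_of_real (lam N j) * s N j (int k + 1))"
      by (rule shift)
    also have "\<dots> = adjacency N (\<lambda>u. if u = int k + 1 then 1 else 0) (int i + 1)"
      using ik by (subst adjacency_point_mass) (auto simp: Gam_def)
    also have "\<dots> = op_mat N (adjacency N) $$ (i, k)"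
      using ik by (simp add: op_mat_def)
    finally show "op_mat N (adjacency N) $$ (i, k) = (S * D * S) $$ (i, k)" by simp
  qed (use carrier in auto)
  then have "similar_mat (op_mat N (adjacency N)) D"
    using carrier SS by (intro similar_matI[of _ _ S S N]) auto
  then have "char_poly (op_mat N (adjacency N)) = char_poly D" by (rule char_poly_similar)
  also have "\<dots> = (\<Prod>a\<leftarrow>diag_mat D. [:- a, 1:])"
    by (rule char_poly_upper_triangular[OF carrier(2)]) (auto simp: D_def)
  also have "diag_mat D = map (\<lambda>k. complex_of_real (lam N (Suc k))) [0..<N]"
    using carrier(2) by (auto simp: diag_mat_def D_def intro!: map_cong)
  also have "(\<Prod>a\<leftarrow>\<dots>. [:- a, 1:]) = (\<Prod>k\<in>{0..<N}. [:- complex_of_real (lam N (Suc k)), 1:])"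
    by (simp add: prod.distinct_set_conv_list[symmetric] o_def)
  also have "\<dots> = (\<Prod>j=1..N. [:- complex_of_real (lam N j), 1:])"
    using prod.shift_bounds_Suc_ivl[of "\<lambda>j. [:- complex_of_real (lam N j), 1:]" 0 N]
    by (simp add: atLeastLessThanSuc_atLeastAtMost)
  \<comment> \<open>Passing from indices to the set of values loses no factor, since the eigenvalues
    are distinct.\<close>
  also have "\<dots> = (\<Prod>\<mu>\<in>(\<lambda>j. complex_of_real (lam N j)) ` {1..N}. [:- \<mu>, 1:])"
  proof -
    have "inj_on (\<lambda>j. complex_of_real (lam N j)) {1..N}"
      by (rule inj_onI) (simp only: of_real_eq_iff lam_eq_iff)
    then show ?thesis by (subst prod.reindex) (auto simp: o_def)
  qed
  finally show ?thesis .
qed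

text \<open>Once the factor at \<open>a\<close> is split off, the remaining roots are other elements
  of the set, so the cofactor does not vanish at \<open>a\<close>.\<close>

lemma order_prod_linear:
  fixes A :: "'a :: idom set"
  assumes "finite A" "a \<in> A"
  shows "order a (\<Prod>\<mu>\<in>A. [:- \<mu>, 1:]) = 1"
proof -
  let ?q = "\<Prod>\<mu>\<in>A - {a}. [:- \<mu>, 1:]"
  have "poly ?q a \<noteq> 0" using assms(1) by (simp add: poly_prod)
  then have q: "order a ?q = 0" "?q \<noteq> 0" by (auto intro: order_0I)
  have "(\<Prod>\<mu>\<in>A. [:- \<mu>, 1:]) = [:- a, 1:] * ?q" by (rule prod.remove[OF assms])
  also have "order a \<dots> = order a [:- a, 1:] + order a ?q"
    using q(2) by (intro order_mult) (metis mult_eq_0_iff pCons_eq_0_iff one_neq_zero)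
  also have "\<dots> = 1" using q(1) order_power_n_n[of a 1] by simp
  finally show ?thesis .
qed

lemma adjacency_eigenvalue_simple:
  assumes "eigenvalue (op_mat N (adjacency N)) \<mu>"
  shows "order \<mu> (char_poly (op_mat N (adjacency N))) = 1"
proof -
  have "op_mat N (adjacency N) \<in> carrier_mat N N" by (simp add: op_mat_def)
  then have "poly (char_poly (op_mat N (adjacency N))) \<mu> = 0"
    using assms by (simp only: eigenvalue_root_char_poly)
  then have "\<mu> \<in> (\<lambda>j. complex_of_real (lam N j)) ` {1..N}"
    unfolding char_poly_adjacency by (auto simp: poly_prod)
  then show ?thesis
    unfolding char_poly_adjacency by (intro order_prod_linear) auto
qed

theorem proposition4p1:
  shows
   "(\<forall>N\<ge>1.
       (\<forall>\<mu>. eigenvalue (op_mat N (adjacency N)) \<mu> \<longrightarrow>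
            order \<mu> (char_poly (op_mat N (adjacency N))) = 1) \<and>
       orthonormal_eigenbasis N (adjacency N) (\<lambda>j. complex_of_real (lam N j)) (s N) \<and>
       (\<forall>\<mu> \<psi>. orthonormal_eigenbasis N (adjacency N) \<mu> \<psi> \<longrightarrow>
          (\<exists>\<sigma> c. bij_betw \<sigma> {1..N} {1..N} \<and>
             (\<forall>j\<in>{1..N}. cmod (c j) = 1 \<and> \<psi> j = (\<lambda>x. c j * s N (\<sigma> j) x) \<and>
                \<mu> j = complex_of_real (lam N (\<sigma> j))))))
    \<and>
    (\<forall>R::nat. \<exists>C::real. \<forall>N\<ge>1. \<forall>j\<in>{1..N}. \<forall>z::int. \<bar>z\<bar> \<le> int R \<longrightarrow>
       cmod (ip N (s N j) (rho N z (s N j))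
             - complex_of_real (cos (real_of_int \<bar>z\<bar> * real j * pi / (real N + 1))))
         \<le> C / real N)
    \<and>
    (\<forall>(R::nat) (K :: nat \<Rightarrow> int \<Rightarrow> int \<Rightarrow> complex) (\<psi> :: nat \<Rightarrow> nat \<Rightarrow> int \<Rightarrow> complex).
       (\<forall>N\<ge>1. \<forall>x\<in>Gam N. \<forall>y\<in>Gam N. \<bar>x - y\<bar> > int R \<longrightarrow> K N x y = 0) \<longrightarrow>
       (\<forall>N\<ge>1. \<forall>x\<in>Gam N. \<forall>y\<in>Gam N. cmod (K N x y) \<le> 1) \<longrightarrow>
       (\<forall>N\<ge>1. orthonormal_eigenbasis N (adjacency N) (\<lambda>j. complex_of_real (lam N j)) (\<psi> N)) \<longrightarrow>
       (\<lambda>N. 1 / real N * (\<Sum>j=1..N.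
          (cmod (ip N (\<psi> N j) (kernel_op N (K N) (\<psi> N j))
             - (\<Sum>z\<in>{z. L N z \<noteq> {}}. \<Sum>x\<in>L N z.
                  1 / of_nat (card (L N z)) * K N x (x + z) *
                  complex_of_real (cos (real_of_int \<bar>z\<bar> * real j * pi / (real N + 1))))))\<^sup>2))
         \<longlonglongrightarrow> 0 \<and>
       (\<lambda>N. 1 / real N * (\<Sum>j=1..N.
          (cmod (ip N (\<psi> N j) (kernel_op N (K N) (\<psi> N j))
             - kernel_avg N (K N) (lam N j)))\<^sup>2))
         \<longlonglongrightarrow> 0)
    \<and>
    (\<forall>N\<ge>1. \<forall>j\<in>{1..N}. \<forall>z::int.
       cos (real_of_int \<bar>z\<bar> * real j * pi / (real N + 1)) = Phi (lam N j) (nat \<bar>z\<bar>))"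
  (is "?a \<and> ?b \<and> ?c \<and> ?d")
proof (intro conjI)
  show ?a
    using adjacency_eigenvalue_simple s_orthonormal_eigenbasis eigenbasis_unique by simp
  show ?b
  proof
    fix R :: nat
    show "\<exists>C::real. \<forall>N\<ge>1. \<forall>j\<in>{1..N}. \<forall>z::int. \<bar>z\<bar> \<le> int R \<longrightarrow>
       cmod (ip N (s N j) (rho N z (s N j))
             - complex_of_real (cos (real_of_int \<bar>z\<bar> * real j * pi / (real N + 1)))) \<le> C / real N"
    \<comment> \<open>The constant is the bound for one translate with \<open>|z|\<close> replaced
      by \<open>R\<close>; the denominator \<open>N + 1\<close> is relaxed to
      \<open>N\<close>.\<close>
    proof (intro exI[of _ "2 * (real R + 1)"] allI ballI impI)
      fix N j :: nat and z :: int
      assume N: "1 \<le> N" and j: "j \<in> {1..N}" and z: "\<bar>z\<bar> \<le> int R"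
      have "cmod (ip N (s N j) (rho N z (s N j)) - complex_of_real (cos (real_of_int \<bar>z\<bar> * theta N j)))
          \<le> 2 * (real_of_int \<bar>z\<bar> + 1) / (real N + 1)"
        by (rule ip_rho_s[OF j])
      also have "\<dots> \<le> 2 * (real R + 1) / real N"
        using N z by (intro frac_le) auto
      finally show "cmod (ip N (s N j) (rho N z (s N j))
             - complex_of_real (cos (real_of_int \<bar>z\<bar> * real j * pi / (real N + 1)))) \<le> 2 * (real R + 1) / real N"
        by (simp add: theta_def mult.assoc)
    qed
  qed
  show ?c
  proof (intro allI impI)
    fix R :: nat and K :: "nat \<Rightarrow> int \<Rightarrow> int \<Rightarrow> complex" and \<psi> :: "nat \<Rightarrow> nat \<Rightarrow> int \<Rightarrow> complex"
    assume band: "\<forall>N\<ge>1. \<forall>x\<in>Gam N. \<forall>y\<in>Gam N. \<bar>x - y\<bar> > int R \<longrightarrow> K N x y = 0"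
      and K: "\<forall>N\<ge>1. \<forall>x\<in>Gam N. \<forall>y\<in>Gam N. cmod (K N x y) \<le> 1"
      and \<psi>: "\<forall>N\<ge>1. orthonormal_eigenbasis N (adjacency N) (\<lambda>j. complex_of_real (lam N j)) (\<psi> N)"
    have eq: "ip N (\<psi> N j) (kernel_op N (K N) (\<psi> N j)) = ip N (s N j) (kernel_op N (K N) (s N j))"
      if N: "1 \<le> N" and j: "j \<in> {1..N}" for N j
    proof -
      obtain c where "cmod c = 1" "\<psi> N j = (\<lambda>x. c * s N j x)"
        using eigenbasis_lam_phase[OF \<psi>[rule_format, OF N] j] by blast
      then show ?thesis by (simp only: ip_kernel_op_phase)
    qed
    \<comment> \<open>\<open>f\<close> stands for either of the two main terms; for the sines both
      obey the same bound.\<close>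
    have transfer: "(\<lambda>N. 1 / real N * (\<Sum>j=1..N.
          (cmod (ip N (\<psi> N j) (kernel_op N (K N) (\<psi> N j)) - f N j))\<^sup>2)) \<longlonglongrightarrow> 0"
      if "\<And>N. 1 \<le> N \<Longrightarrow> (\<Sum>j=1..N. (cmod (ip N (s N j) (kernel_op N (K N) (s N j)) - f N j))\<^sup>2)
        \<le> (2 * real R + 1)\<^sup>2 * (2 * (real R + 1)\<^sup>2 + 2)" for f
    proof (rule tendsto_average_zero)
      fix N :: nat assume N: "1 \<le> N"
      have "(\<Sum>j=1..N. (cmod (ip N (\<psi> N j) (kernel_op N (K N) (\<psi> N j)) - f N j))\<^sup>2)
          = (\<Sum>j=1..N. (cmod (ip N (s N j) (kernel_op N (K N) (s N j)) - f N j))\<^sup>2)"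
        by (intro sum.cong refl) (simp only: eq[OF N])
      then show "(\<Sum>j=1..N. (cmod (ip N (\<psi> N j) (kernel_op N (K N) (\<psi> N j)) - f N j))\<^sup>2)
          \<le> (2 * real R + 1)\<^sup>2 * (2 * (real R + 1)\<^sup>2 + 2)"
        using that[OF N] by (simp only:)
    qed (simp add: sum_nonneg)
    show "(\<lambda>N. 1 / real N * (\<Sum>j=1..N.
          (cmod (ip N (\<psi> N j) (kernel_op N (K N) (\<psi> N j))
             - (\<Sum>z\<in>{z. L N z \<noteq> {}}. \<Sum>x\<in>L N z.
                  1 / of_nat (card (L N z)) * K N x (x + z) *
                  complex_of_real (cos (real_of_int \<bar>z\<bar> * real j * pi / (real N + 1))))))\<^sup>2))
         \<longlonglongrightarrow> 0 \<and>
       (\<lambda>N. 1 / real N * (\<Sum>j=1..N.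
          (cmod (ip N (\<psi> N j) (kernel_op N (K N) (\<psi> N j))
             - kernel_avg N (K N) (lam N j)))\<^sup>2))
         \<longlonglongrightarrow> 0"
    proof (intro conjI transfer)
      fix N :: nat assume N: "1 \<le> N"
      note local_average = ip_kernel_vs_local_average[OF band[THEN spec, THEN mp, OF N] K[THEN spec, THEN mp, OF N]]
        and kernel_average = ip_kernel_vs_kernel_avg[OF N band[THEN spec, THEN mp, OF N] K[THEN spec, THEN mp, OF N]]
      show "(\<Sum>j=1..N. (cmod (ip N (s N j) (kernel_op N (K N) (s N j))
           - (\<Sum>z\<in>{z. L N z \<noteq> {}}. \<Sum>x\<in>L N z. 1 / of_nat (card (L N z)) * K N x (x + z) *
               complex_of_real (cos (real_of_int \<bar>z\<bar> * real j * pi / (real N + 1))))))\<^sup>2)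
         \<le> (2 * real R + 1)\<^sup>2 * (2 * (real R + 1)\<^sup>2 + 2)"
        by (rule local_average)
      show "(\<Sum>j=1..N. (cmod (ip N (s N j) (kernel_op N (K N) (s N j)) - kernel_avg N (K N) (lam N j)))\<^sup>2)
         \<le> (2 * real R + 1)\<^sup>2 * (2 * (real R + 1)\<^sup>2 + 2)"
        by (rule kernel_average)
    qed
  qed
  show ?d
    by (auto simp: Phi_lam theta_def mult.assoc)
qed

end
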